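(* There exists a real $\theta>\log_2 3$ such that $\pi(\vec T_k,\theta)=1$ for all integers $k\ge 4$.
   Context: A partially directed $k$-graph ($k$-PDG) on a vertex set $V$ specifies for each $k$-subset $S\subseteq V$ exactly one of: no edge on $S$; an undirected edge on $S$; or a directed edge on $S$ directed toward a chosen vertex of $S$. For an $n$-vertex $k$-PDG $\vec H$, $\alpha(\vec H)=e_u(\vec H)/\binom nk$ and $\beta(\vec H)=e_d(\vec H)/\binom nk$ where $e_u,e_d$ count undirected and directed edges. $\vec F$ is a subgraph of $\vec H$ if a $k$-PDG isomorphic to $\vec F$ can be obtained from $\vec H$ by deleting edges, deleting vertices and forgetting directions of edges; $\vec H$ is $\vec F$-free otherwise. $\vec T_k$ is the $k$-PDG on $\{1,\dots,k+1\}$ with undirected edges $\{1,\dots,k\}$, $\{2,\dots,k+1\}$ and the edge $\{1,\dots,k-1,k+1\}$ directed toward $k+1$. $\pi(\vec F,\theta)$ is the smallest real number such that every $n$-vertex $\vec F$-free $k$-PDG $\vec H$ satisfies $\alpha(\vec H)+\theta\beta(\vec H)\le\pi(\vec F,\theta)+o_{n\to\infty}(1)$. *)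

theory Defs
  imports Complex_Main
begin

datatype 'a edge_state = No_Edge | Undirected | Directed 'a

record 'a pdg =
  pverts :: "'a set"
  pstate :: "'a set \<Rightarrow> 'a edge_state"

definition ksubsets :: "nat \<Rightarrow> 'a set \<Rightarrow> 'a set set" where
  "ksubsets k V = {S. S \<subseteq> V \<and> finite S \<and> card S = k}"

text \<open>The state function is total; its value is pinned to \<open>No_Edge\<close> on all sets
  that are not $k$-subsets of the vertex set.\<close>

definition is_kpdg :: "nat \<Rightarrow> 'a pdg \<Rightarrow> bool" where
  "is_kpdg k H \<longleftrightarrow>
     (\<forall>S. S \<notin> ksubsets k (pverts H) \<longrightarrow> pstate H S = No_Edge) \<and>
     (\<forall>S v. pstate H S = Directed v \<longrightarrow> v \<in> S)"

definition undirected_edges :: "nat \<Rightarrow> 'a pdg \<Rightarrow> 'a set set" where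
  "undirected_edges k H = {S \<in> ksubsets k (pverts H). pstate H S = Undirected}"

definition directed_edges :: "nat \<Rightarrow> 'a pdg \<Rightarrow> 'a set set" where
  "directed_edges k H = {S \<in> ksubsets k (pverts H). \<exists>v. pstate H S = Directed v}"

definition pdg_alpha :: "nat \<Rightarrow> 'a pdg \<Rightarrow> real" where
  "pdg_alpha k H = real (card (undirected_edges k H)) / real (card (pverts H) choose k)"

definition pdg_beta :: "nat \<Rightarrow> 'a pdg \<Rightarrow> real" where
  "pdg_beta k H = real (card (directed_edges k H)) / real (card (pverts H) choose k)"

definition pdg_iso :: "nat \<Rightarrow> 'a pdg \<Rightarrow> 'b pdg \<Rightarrow> bool" where
  "pdg_iso k F G \<longleftrightarrow>
     (\<exists>f. bij_betw f (pverts F) (pverts G) \<and>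
          (\<forall>S \<in> ksubsets k (pverts F). pstate G (f ` S) = map_edge_state f (pstate F S)))"

text \<open>\<open>pdg_reduces k H G\<close>: \<open>G\<close> arises from \<open>H\<close> by deleting vertices (together with the
  edges containing them), deleting edges (second disjunct) and forgetting directions
  (third disjunct).\<close>

definition pdg_reduces :: "nat \<Rightarrow> 'a pdg \<Rightarrow> 'a pdg \<Rightarrow> bool" where
  "pdg_reduces k H G \<longleftrightarrow>
     pverts G \<subseteq> pverts H \<and>
     (\<forall>S \<in> ksubsets k (pverts G).
        pstate G S = pstate H S \<or>
        pstate G S = No_Edge \<or>
        (pstate G S = Undirected \<and> (\<exists>v. pstate H S = Directed v)))"

definition pdg_subgraph :: "nat \<Rightarrow> 'a pdg \<Rightarrow> 'b pdg \<Rightarrow> bool" where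
  "pdg_subgraph k F H \<longleftrightarrow> (\<exists>G. is_kpdg k G \<and> pdg_reduces k H G \<and> pdg_iso k F G)"

definition pdg_free :: "nat \<Rightarrow> 'a pdg \<Rightarrow> 'b pdg \<Rightarrow> bool" where
  "pdg_free k F H \<longleftrightarrow> \<not> pdg_subgraph k F H"

text \<open>Every finite $k$-PDG is isomorphic to one whose vertices are natural numbers, so it
  suffices to let \<open>H\<close> range over those. The sequence \<open>\<epsilon>\<close> is the $o(1)$ term.\<close>

definition pdg_pi :: "nat \<Rightarrow> 'a pdg \<Rightarrow> real \<Rightarrow> real" where
  "pdg_pi k F \<theta> = (LEAST x::real. \<exists>\<epsilon>::nat \<Rightarrow> real. \<epsilon> \<longlonglongrightarrow> 0 \<and>
     (\<forall>H::nat pdg. finite (pverts H) \<longrightarrow> is_kpdg k H \<longrightarrow> pdg_free k F H \<longrightarrow>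
        pdg_alpha k H + \<theta> * pdg_beta k H \<le> x + \<epsilon> (card (pverts H))))"

definition T_pdg :: "nat \<Rightarrow> nat pdg" where
  "T_pdg k = \<lparr> pverts = {1..k+1},
     pstate = (\<lambda>S. if S = {1..k} \<or> S = {2..k+1} then Undirected
                   else if S = insert (k+1) {1..k-1} then Directed (k+1)
                   else No_Edge) \<rparr>"

lemma T_pdg_is_kpdg:
  assumes "k \<ge> 2"
  shows "is_kpdg k (T_pdg k)"
proof -
  have "card (insert (k+1) {1..k-1}) = k"
    using assms by (subst card_insert_disjoint) auto
  then show ?thesis
    using assms by (auto simp: is_kpdg_def T_pdg_def ksubsets_def split: if_splits)
qed

end

theory Submission imports Defs begin

text \<open>
  We take \<open>\<theta> = 8/5\<close>; it exceeds \<open>log\<^sub>2 3\<close> because \<open>2\<^sup>8 = 256 > 243 = 3\<^sup>5\<close>. Since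
  \<open>\<alpha> + \<theta>\<beta> \<le> 1\<close> says that the density of non-edges is at least \<open>3/5 \<beta>\<close>, the aim is to bound
  non-edges from below. For a $(k-1)$-set \<open>R\<close> let \<open>h\<^sub>R\<close> be the number of \<open>c\<close> such that
  \<open>R \<union> {c}\<close> is directed toward \<open>c\<close>, let \<open>n\<^sub>R\<close> be the number of \<open>c\<close> such that \<open>R \<union> {c}\<close> is
  not an edge, and expand \<open>0 \<le> \<Sum>\<^sub>R (t h\<^sub>R - n\<^sub>R)\<^sup>2\<close> with \<open>t = 3k/5 - 1\<close>. The diagonal terms are of
  lower order and the others are grouped by the $(k+1)$-set \<open>W = R \<union> {c, c'}\<close>. Freeness from
  \<open>T_pdg k\<close> means that either every directed edge \<open>W - {c}\<close> points at some \<open>a\<close> for which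
  \<open>W - {a}\<close> is not an edge, or \<open>W\<close> contains exactly two edges. In both cases the contribution of
  \<open>W\<close> is at most \<open>2k (m - 3/5 d)\<close>, where \<open>m\<close> and \<open>d\<close> count the non-edges and the directed edges
  in \<open>W\<close>; summing over \<open>W\<close> gives the upper bound. The complete undirected \<open>k\<close>-graph gives the
  lower bound.
\<close>

section \<open>The local inequality on a \<open>(k+1)\<close>-set\<close>

text \<open>With \<open>s\<close> the state of \<open>R \<union> {c}\<close>, summing these weights
  over all \<open>c\<close> outside \<open>R\<close> gives
  \<open>t h\<^sub>R - n\<^sub>R\<close>.\<close>

definition flag_weight :: "nat \<Rightarrow> 'a edge_state \<Rightarrow> 'a \<Rightarrow> real" where
  "flag_weight k s c =
     (if s = Directed c then 3 / 5 * real k - 1 else if s = No_Edge then -1 else 0)"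

text \<open>Here \<open>s c\<close> stands for the state of the \<open>k\<close>-set \<open>W - {c}\<close>.\<close>

lemma local_quadratic_bound:
  fixes s :: "'a \<Rightarrow> 'a edge_state"
  assumes fin: "finite W" and card_W: "card W = k + 1" and k: "k \<ge> 4"
    and head: "\<And>c a. c \<in> W \<Longrightarrow> s c = Directed a \<Longrightarrow> a \<in> W \<and> a \<noteq> c"
    and free: "\<And>a b c. a \<in> W \<Longrightarrow> b \<in> W \<Longrightarrow> c \<in> W \<Longrightarrow> a \<noteq> b \<Longrightarrow> a \<noteq> c \<Longrightarrow> b \<noteq> c \<Longrightarrow>
      s c = Directed a \<Longrightarrow> s a \<noteq> No_Edge \<Longrightarrow> s b = No_Edge"
  shows "(\<Sum>c\<in>W. \<Sum>c'\<in>W - {c}. flag_weight k (s c) c' * flag_weight k (s c') c)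
      + 6 / 5 * real k * real (card {c\<in>W. \<exists>a. s c = Directed a})
      \<le> 2 * real k * real (card {c\<in>W. s c = No_Edge})"
proof -
  \<comment> \<open>This is the least \<open>t\<close> for which the bound holds when one
    \<open>W - {a}\<close> is missing and the other \<open>k\<close> sets are all directed toward
    \<open>a\<close>; there it is an equality.\<close>
  define t where "t = 3 / 5 * real k - 1"
  define M where "M = {c\<in>W. s c = No_Edge}"
  define D where "D = {c\<in>W. \<exists>a. s c = Directed a}"
  define DM where "DM = {c\<in>W. \<exists>a\<in>M. s c = Directed a}"
  have t: "t \<ge> 0" using k by (simp add: t_def)
  have finM: "finite M" "finite D" "finite DM" and sub: "M \<subseteq> W" "D \<subseteq> W" "M \<inter> D = {}"
    using fin by (auto simp: M_def D_def DM_def)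
  have card_MD: "card M + card D \<le> k + 1"
    using card_Un_disjoint[of M D] card_mono[of W "M \<union> D"] fin finM sub card_W by auto
  \<comment> \<open>A product of two weights can be nonzero only if \<open>W - {c}\<close> and
    \<open>W - {c'}\<close> point at \<open>c'\<close> and \<open>c\<close> respectively
    (\<open>P\<close>), one of them does so and the other is missing (\<open>A\<close>), or both are
    missing (\<open>B\<close>).\<close>
  define P where "P c c' = (of_bool (s c = Directed c' \<and> s c' = Directed c) :: real)" for c c'
  define A where "A c c' = (of_bool (s c = Directed c' \<and> c' \<in> M) :: real)" for c c'
  define B where "B c c' = (of_bool (c \<in> M \<and> c' \<in> M) :: real)" for c c'
  have expand: "flag_weight k (s c) c' * flag_weight k (s c') c
      = t\<^sup>2 * P c c' - t * A c c' - t * A c' c + B c c'" if "c \<in> W" "c' \<in> W" for c c'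
    using that
    by (auto simp: flag_weight_def P_def A_def B_def M_def t_def power2_eq_square)
  have sumP: "(\<Sum>c'\<in>W - {c}. P c c') \<le> of_bool (c \<in> D)" if "c \<in> W" for c
  proof (cases "\<exists>a. s c = Directed a")
    case True
    then obtain a where a: "s c = Directed a" by blast
    have "(\<Sum>c'\<in>W - {c}. P c c') \<le> (\<Sum>c'\<in>W - {c}. if c' = a then 1 else 0)"
      by (rule sum_mono) (auto simp: P_def a)
    also have "\<dots> \<le> 1" using fin by simp
    finally show ?thesis using a that by (simp add: D_def)
  qed (auto simp: P_def D_def)
  have row: "(\<Sum>c'\<in>W - {c}. A c c') = of_bool (c \<in> DM)" if "c \<in> W" for c
  proof (cases "\<exists>a. s c = Directed a")
    case True
    then obtain a where a: "s c = Directed a" by blast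
    have "(\<Sum>c'\<in>W - {c}. A c c') = (\<Sum>c'\<in>W - {c}. if c' = a then of_bool (a \<in> M) else 0)"
      by (rule sum.cong) (auto simp: A_def a)
    also have "\<dots> = of_bool (a \<in> M)" using fin head[OF that a] by simp
    finally show ?thesis using a that by (simp add: DM_def)
  qed (auto simp: A_def DM_def)
  have A_diag: "A c c = 0" if "c \<in> W" for c
    using head[OF that] by (auto simp: A_def)
  have card_sum: "(\<Sum>c\<in>W. of_bool (c \<in> X)) = real (card X)" if "X \<subseteq> W" for X
    using that fin by (simp add: of_bool_def sum.If_cases Int_absorb1)
  have sumA: "(\<Sum>c\<in>W. \<Sum>c'\<in>W - {c}. A c c') = real (card DM)"
    using row card_sum[of DM] by (simp add: DM_def)
  have sumA': "(\<Sum>c\<in>W. \<Sum>c'\<in>W - {c}. A c' c) = real (card DM)"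
  proof -
    \<comment> \<open>Since \<open>A\<close> vanishes on the diagonal, the sum extends to all of
      \<open>W\<close>, where it can be transposed.\<close>
    have "(\<Sum>c\<in>W. \<Sum>c'\<in>W - {c}. A c' c) = (\<Sum>c\<in>W. \<Sum>c'\<in>W. A c' c)"
      using fin A_diag by (intro sum.cong refl sum.mono_neutral_left) auto
    also have "\<dots> = (\<Sum>c\<in>W. \<Sum>c'\<in>W. A c c')" by (rule sum.swap)
    also have "\<dots> = (\<Sum>c\<in>W. \<Sum>c'\<in>W - {c}. A c c')"
      using fin A_diag by (intro sum.cong refl sum.mono_neutral_right) auto
    finally show ?thesis using sumA by simp
  qed
  have sumB: "(\<Sum>c\<in>W. \<Sum>c'\<in>W - {c}. B c c') = real (card M) * (real (card M) - 1)"
  proof -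
    have "(\<Sum>c'\<in>W - {c}. B c c') = of_bool (c \<in> M) * (real (card M) - 1)" if "c \<in> W" for c
    proof (cases "c \<in> M")
      case True
      have "(\<Sum>c'\<in>W. B c c') = real (card M)"
        using True card_sum[OF sub(1)] by (simp add: B_def)
      moreover have "B c c = 1" using True by (simp add: B_def)
      ultimately show ?thesis using True that fin by (simp add: sum_diff1 del: sum_of_bool_eq)
    qed (auto simp: B_def)
    then have "(\<Sum>c\<in>W. \<Sum>c'\<in>W - {c}. B c c') = (\<Sum>c\<in>W. of_bool (c \<in> M) * (real (card M) - 1))"
      by (intro sum.cong) auto
    then show ?thesis using card_sum[OF sub(1)] by (simp only: sum_distrib_right[symmetric])
  qed
  define p where "p = (\<Sum>c\<in>W. \<Sum>c'\<in>W - {c}. P c c')"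
  define m where "m = real (card M)"
  define d where "d = real (card D)"
  define q where "q = real (card DM)"
  have "(\<Sum>c\<in>W. \<Sum>c'\<in>W - {c}. flag_weight k (s c) c' * flag_weight k (s c') c)
     = (\<Sum>c\<in>W. \<Sum>c'\<in>W - {c}. t\<^sup>2 * P c c' - t * A c c' - t * A c' c + B c c')"
    using expand by (intro sum.cong) auto
  also have "\<dots> = t\<^sup>2 * p - t * q - t * q + m * (m - 1)"
    using sumA sumA' sumB
    by (simp add: sum.distrib sum_subtractf sum_distrib_left[symmetric] p_def m_def q_def)
  finally have total: "(\<Sum>c\<in>W. \<Sum>c'\<in>W - {c}. flag_weight k (s c) c' * flag_weight k (s c') c)
     = t\<^sup>2 * p - 2 * t * q + m * (m - 1)" by simp
  have p_le: "p \<le> d"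
  proof -
    have "p \<le> (\<Sum>c\<in>W. of_bool (c \<in> D))"
      unfolding p_def using sumP by (intro sum_mono) auto
    then show ?thesis using card_sum[OF sub(2)] by (simp add: d_def)
  qed
  have "t\<^sup>2 * p - 2 * t * q + m * (m - 1) + 6 / 5 * real k * d \<le> 2 * real k * m"
  proof (cases "DM = D")
    case True
    \<comment> \<open>If \<open>W - {c}\<close> points at \<open>c'\<close>, then
      \<open>W - {c'}\<close> is missing and cannot point back.\<close>
    have "p = 0" unfolding p_def
    proof (intro sum.neutral ballI)
      fix c c' assume "c \<in> W" "c' \<in> W - {c}"
      then show "P c c' = 0"
        using True by (force simp: P_def DM_def D_def M_def)
    qed
    moreover have "q = d" using True by (simp add: q_def d_def)
    moreover have "2 * d + m * (m - 1) \<le> 2 * real k * m"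
    proof (cases "M = {}")
      case True
      then have "D = {}" using \<open>DM = D\<close> by (auto simp: DM_def)
      then show ?thesis using True by (simp add: d_def m_def)
    next
      case False
      then have "m \<ge> 1" using finM by (simp add: m_def Suc_le_eq card_gt_0_iff)
      moreover have "d \<le> real k + 1 - m" using card_MD by (simp add: d_def m_def)
      \<comment> \<open>After \<open>d\<close> is replaced by its bound \<open>k + 1 - m\<close>,
        the slack in the claim is exactly \<open>(m - 1) * (2 * k + 2 - m)\<close>.\<close>
      moreover have "m \<le> real k + 1" using card_MD by (simp add: m_def)
      ultimately have "(m - 1) * (2 * real k + 2 - m) \<ge> 0"
        by (intro mult_nonneg_nonneg) auto
      then show ?thesis using \<open>d \<le> real k + 1 - m\<close> by (simp add: algebra_simps)
    qed
    ultimately show ?thesis by (simp add: t_def algebra_simps)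
  next
    case False
    then obtain c a where ca: "c \<in> W" "s c = Directed a" "a \<notin> M"
      by (auto simp: D_def DM_def)
    have a: "a \<in> W" "a \<noteq> c" using head[OF ca(1,2)] by auto
    \<comment> \<open>Here \<open>W - {a}\<close> is an edge, so freeness leaves no edge
      \<open>W - {b}\<close> for any third vertex \<open>b\<close>.\<close>
    have "W - {a, c} \<subseteq> M"
    proof
      fix b assume "b \<in> W - {a, c}"
      then show "b \<in> M" using free[of a b c] ca a by (auto simp: M_def)
    qed
    then have M_eq: "M = W - {a, c}" using ca a by (auto simp: M_def)
    then have "card M = k - 1" using ca a card_W fin by (simp add: card_Diff_subset)
    then have m: "m = real k - 1" using k by (simp add: m_def)
    have "D \<subseteq> {a, c}" using sub M_eq by auto
    then have "card D \<le> 2" using card_mono[of "{a, c}" D] a(2) by simp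
    then have d: "d \<le> 2" by (simp add: d_def)
    have "t\<^sup>2 * p \<le> t\<^sup>2 * 2" using p_le d by (intro mult_left_mono) auto
    moreover have "t * q \<ge> 0" using t by (simp add: q_def)
    moreover have "6 / 5 * real k * d \<le> 6 / 5 * real k * 2" using d by (intro mult_left_mono) auto
    \<comment> \<open>The right side exceeds the left by \<open>7/25 k^2 + k - 4\<close>.\<close>
    moreover have "t\<^sup>2 * 2 + (real k - 1) * (real k - 2) + 6 / 5 * real k * 2
        \<le> 2 * real k * (real k - 1)"
    proof -
      have "real k * real k \<ge> 4 * 4" using k by (intro mult_mono) auto
      then show ?thesis using k by (simp add: t_def power2_eq_square algebra_simps)
    qed
    ultimately show ?thesis unfolding m by (simp add: mult.commute mult.left_commute)
  qed
  then show ?thesis using total by (simp add: M_def D_def m_def d_def)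
qed

section \<open>Recognising \<open>T_pdg k\<close> inside a \<open>(k+1)\<close>-set\<close>

text \<open>The undirected edges of \<open>T_pdg k\<close> omit \<open>k+1\<close> and
  \<open>1\<close>, and the edge directed toward \<open>k+1\<close> omits \<open>k\<close>. So
  \<open>a\<close>, \<open>b\<close>, \<open>c\<close> play the roles of \<open>k+1\<close>,
  \<open>1\<close>, \<open>k\<close>; forgetting directions allows \<open>W - {a}\<close> and
  \<open>W - {b}\<close> to be edges of either kind.\<close>

lemma T_pdg_subgraphI:
  assumes W: "W \<in> ksubsets (k + 1) (pverts H)" and k: "k \<ge> 2"
    and abc: "a \<in> W" "b \<in> W" "c \<in> W" "a \<noteq> b" "a \<noteq> c" "b \<noteq> c"
    and dir: "pstate H (W - {c}) = Directed a"
    and edges: "pstate H (W - {a}) \<noteq> No_Edge" "pstate H (W - {b}) \<noteq> No_Edge"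
  shows "pdg_subgraph k (T_pdg k) H"
proof -
  have fin: "finite W" and card_W: "card W = k + 1" and sub: "W \<subseteq> pverts H"
    using W by (auto simp: ksubsets_def)
  define st where "st S = (if S = W - {a} \<or> S = W - {b} then Undirected
      else if S = W - {c} then Directed a else No_Edge)" for S
  define G where "G = \<lparr>pverts = W, pstate = st\<rparr>"
  have minus_inj: "W - {x} = W - {y} \<longleftrightarrow> x = y" if "x \<in> W" "y \<in> W" for x y
    using that by blast
  have "is_kpdg k G"
    using abc fin card_W by (auto simp: is_kpdg_def G_def st_def ksubsets_def split: if_splits)
  moreover have "pdg_reduces k H G"
    using sub dir edges
    by (auto simp: pdg_reduces_def G_def st_def) (metis edge_state.exhaust)+
  moreover have "pdg_iso k (T_pdg k) G"
  proof -
    \<comment> \<open>The remaining vertices play symmetric roles, so any bijection between them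
      will do.\<close>
    have "card ({1..k+1} - {1, k, k+1}) = card (W - {a, b, c})"
      using k abc fin card_W by (simp add: card_Diff_subset)
    then obtain g where g: "bij_betw g ({1..k+1} - {1, k, k+1}) (W - {a, b, c})"
      using finite_same_card_bij fin by blast
    define f where "f = g(k+1 := a, 1 := b, k := c)"
    have f_vals: "f (k+1) = a" "f 1 = b" "f k = c" using k by (auto simp: f_def)
    have "bij_betw f ({1..k+1} - {1, k, k+1}) (W - {a, b, c})"
      using g by (rule bij_betw_cong[THEN iffD1, rotated]) (auto simp: f_def)
    moreover have "bij_betw f {1, k, k+1} {a, b, c}"
      using abc f_vals k by (auto simp: bij_betw_def inj_on_def)
    ultimately have "bij_betw f (({1..k+1} - {1, k, k+1}) \<union> {1, k, k+1}) ((W - {a, b, c}) \<union> {a, b, c})"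
      by (rule bij_betw_combine) auto
    moreover have "({1..k+1} - {1, k, k+1}) \<union> {1, k, k+1} = {1..k+1}"
      "(W - {a, b, c}) \<union> {a, b, c} = W" using k abc by auto
    ultimately have f: "bij_betw f {1..k+1} W" by simp
    have "st (f ` S) = map_edge_state f (pstate (T_pdg k) S)" if S: "S \<in> ksubsets k {1..k+1}" for S
    proof -
      \<comment> \<open>A \<open>k\<close>-subset is determined by the one vertex \<open>j\<close>
        it omits, so comparing states reduces to comparing \<open>j\<close> with \<open>k+1\<close>,
        \<open>1\<close> and \<open>k\<close>.\<close>
      have "card ({1..k+1} - S) = 1"
        using S by (auto simp: ksubsets_def card_Diff_subset)
      then obtain j where "{1..k+1} - S = {j}" by (auto simp: card_1_singleton_iff)
      then have j: "j \<in> {1..k+1}" and S_eq: "S = {1..k+1} - {j}"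
        using S by (auto simp: ksubsets_def)
      have img: "f ` S = W - {f j}"
        using f j unfolding S_eq bij_betw_def by (simp add: inj_on_image_set_diff[of f "{1..k+1}"])
      have fj: "f j \<in> W" using f j by (auto simp: bij_betw_def)
      have inj: "f j = f i \<longleftrightarrow> j = i" if "i \<in> {1..k+1}" for i
        using f j that by (auto simp: bij_betw_def inj_on_def)
      have eqs: "f j = a \<longleftrightarrow> j = k+1" "f j = b \<longleftrightarrow> j = 1" "f j = c \<longleftrightarrow> j = k"
        using inj[of "k+1"] inj[of 1] inj[of k] f_vals k by auto
      have "{1..k} = {1..k+1} - {k+1}" "{2..k+1} = {1..k+1} - {1}"
        "insert (k+1) {1..k-1} = {1..k+1} - {k}" using k by auto
      moreover have "{1..k+1} - {j} = {1..k+1} - {i} \<longleftrightarrow> j = i" if "i \<in> {1..k+1}" for i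
        using j that by blast
      ultimately have "S = {1..k} \<longleftrightarrow> j = k+1" "S = {2..k+1} \<longleftrightarrow> j = 1"
        "S = insert (k+1) {1..k-1} \<longleftrightarrow> j = k"
        using k unfolding S_eq by simp_all
      then show ?thesis
        using eqs f_vals minus_inj[OF fj] abc unfolding img st_def T_pdg_def by auto
    qed
    then show ?thesis
      unfolding pdg_iso_def using f by (intro exI[of _ f]) (simp add: G_def T_pdg_def)
  qed
  ultimately show ?thesis unfolding pdg_subgraph_def by blast
qed

section \<open>Double counting over subsets\<close>

lemma finite_ksubsets: "finite V \<Longrightarrow> finite (ksubsets k V)"
  by (rule finite_subset[of _ "Pow V"]) (auto simp: ksubsets_def)

lemma card_ksubsets: "finite V \<Longrightarrow> card (ksubsets k V) = card V choose k"
proof -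
  assume "finite V"
  then have "ksubsets k V = {S. S \<subseteq> V \<and> card S = k}"
    by (auto simp: ksubsets_def intro: finite_subset)
  then show ?thesis using n_subsets[OF \<open>finite V\<close>] by simp
qed

text \<open>Pairs \<open>(R, c)\<close> with \<open>c\<close> outside \<open>R\<close> correspond to
  sets \<open>S = insert c R\<close> with a marked element \<open>c\<close>.\<close>

lemma sum_ksubsets_insert:
  fixes \<phi> :: "'a set \<Rightarrow> 'a \<Rightarrow> real"
  assumes "finite V"
  shows "(\<Sum>R\<in>ksubsets j V. \<Sum>c\<in>V - R. \<phi> (insert c R) c) = (\<Sum>S\<in>ksubsets (Suc j) V. \<Sum>c\<in>S. \<phi> S c)"
proof -
  have "(\<Sum>R\<in>ksubsets j V. \<Sum>c\<in>V - R. \<phi> (insert c R) c)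
      = (\<Sum>(R, c)\<in>(SIGMA R:ksubsets j V. V - R). \<phi> (insert c R) c)"
    using assms finite_ksubsets by (subst sum.Sigma) auto
  also have "\<dots> = (\<Sum>(S, c)\<in>(SIGMA S:ksubsets (Suc j) V. S). \<phi> S c)"
    by (rule sum.reindex_bij_witness[where
          i = "\<lambda>(S, c). (S - {c}, c)" and j = "\<lambda>(R, c). (insert c R, c)"])
      (auto simp: ksubsets_def insert_absorb)
  also have "\<dots> = (\<Sum>S\<in>ksubsets (Suc j) V. \<Sum>c\<in>S. \<phi> S c)"
    using assms finite_ksubsets by (subst sum.Sigma) (auto simp: ksubsets_def)
  finally show ?thesis .
qed

text \<open>Each \<open>k\<close>-set \<open>S\<close> arises as \<open>W - {c}\<close> once for
  every vertex \<open>c\<close> outside \<open>S\<close>.\<close>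

lemma sum_ksubsets_remove:
  fixes \<phi> :: "'a set \<Rightarrow> real"
  assumes "finite V"
  shows "(\<Sum>W\<in>ksubsets (Suc k) V. \<Sum>c\<in>W. \<phi> (W - {c}))
    = (real (card V) - real k) * (\<Sum>S\<in>ksubsets k V. \<phi> S)"
proof -
  have "(\<Sum>c\<in>V - S. \<phi> (insert c S - {c})) = (real (card V) - real k) * \<phi> S"
    if "S \<in> ksubsets k V" for S
  proof -
    have S: "S \<subseteq> V" "finite S" "card S = k" using that by (auto simp: ksubsets_def)
    have "(\<Sum>c\<in>V - S. \<phi> (insert c S - {c})) = (\<Sum>c\<in>V - S. \<phi> S)" by (intro sum.cong) auto
    then show ?thesis
      using S card_mono[OF assms S(1)] by (simp add: card_Diff_subset of_nat_diff)
  qed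
  then have "(\<Sum>S\<in>ksubsets k V. \<Sum>c\<in>V - S. \<phi> (insert c S - {c}))
      = (\<Sum>S\<in>ksubsets k V. (real (card V) - real k) * \<phi> S)"
    by (rule sum.cong[OF refl])
  then show ?thesis
    using sum_ksubsets_insert[OF assms, of "\<lambda>W c. \<phi> (W - {c})" k]
    by (simp only: sum_distrib_left)
qed

text \<open>In the expanded square, equal indices give \<open>S = R \<union> {c}\<close>, while
  distinct ones give \<open>W = R \<union> {c, c'}\<close>, in which
  \<open>R \<union> {c'} = W - {c}\<close> and \<open>R \<union> {c} = W - {c'}\<close>.\<close>

lemma sum_square_ksubsets:
  fixes g :: "'a set \<Rightarrow> 'a \<Rightarrow> real"
  assumes fin: "finite V"
  shows "(\<Sum>R\<in>ksubsets j V. (\<Sum>c\<in>V - R. g (insert c R) c)\<^sup>2) =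
    (\<Sum>S\<in>ksubsets (Suc j) V. \<Sum>c\<in>S. (g S c)\<^sup>2) +
    (\<Sum>W\<in>ksubsets (Suc (Suc j)) V. \<Sum>c\<in>W. \<Sum>c'\<in>W - {c}. g (W - {c}) c' * g (W - {c'}) c)"
proof -
  \<comment> \<open>\<open>\<psi> S c\<close> collects the products of the \<open>c\<close> term
    with the other terms for \<open>R = S - {c}\<close>. It depends only on the marked set, so
    \<open>sum_ksubsets_insert\<close> applies, first to pass from \<open>R\<close> to
    \<open>S\<close> and then from \<open>S\<close> to \<open>W\<close>.\<close>
  define \<psi> where "\<psi> S c = (\<Sum>c'\<in>V - S. g S c * g (insert c' (S - {c})) c')" for S c
  have split: "(\<Sum>c\<in>V - R. g (insert c R) c)\<^sup>2
      = (\<Sum>c\<in>V - R. (g (insert c R) c)\<^sup>2 + \<psi> (insert c R) c)" for R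
  proof -
    have "(\<Sum>c'\<in>V - R. g (insert c R) c * g (insert c' R) c')
        = (g (insert c R) c)\<^sup>2 + \<psi> (insert c R) c" if "c \<in> V - R" for c
    proof -
      have "V - insert c R = V - R - {c}" "insert c R - {c} = R" using that by auto
      then show ?thesis
        using that fin unfolding \<psi>_def by (simp add: sum.remove[of _ c] power2_eq_square)
    qed
    then show ?thesis by (simp add: power2_eq_square sum_product)
  qed
  have "(\<Sum>R\<in>ksubsets j V. (\<Sum>c\<in>V - R. g (insert c R) c)\<^sup>2) =
    (\<Sum>S\<in>ksubsets (Suc j) V. \<Sum>c\<in>S. (g S c)\<^sup>2 + \<psi> S c)"
    using sum_ksubsets_insert[OF fin, of "\<lambda>S c. (g S c)\<^sup>2 + \<psi> S c" j] by (simp add: split)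
  moreover have "(\<Sum>S\<in>ksubsets (Suc j) V. \<Sum>c\<in>S. \<psi> S c) =
    (\<Sum>W\<in>ksubsets (Suc (Suc j)) V. \<Sum>c\<in>W. \<Sum>c'\<in>W - {c}. g (W - {c}) c' * g (W - {c'}) c)"
  proof -
    have "(\<Sum>c\<in>S. \<psi> S c) = (\<Sum>c'\<in>V - S. \<Sum>c\<in>insert c' S - {c'}.
        g (insert c' S - {c'}) c * g (insert c' S - {c}) c')" for S
    proof -
      have "(\<Sum>c\<in>S. \<psi> S c) = (\<Sum>c'\<in>V - S. \<Sum>c\<in>S. g S c * g (insert c' (S - {c})) c')"
        unfolding \<psi>_def by (rule sum.swap)
      also have "\<dots> = (\<Sum>c'\<in>V - S. \<Sum>c\<in>insert c' S - {c'}.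
        g (insert c' S - {c'}) c * g (insert c' S - {c}) c')"
      proof (intro sum.cong refl)
        fix c' c assume "c' \<in> V - S" "c \<in> insert c' S - {c'}"
        then have "insert c' S - {c'} = S" "insert c' (S - {c}) = insert c' S - {c}" by auto
        then show "g S c * g (insert c' (S - {c})) c'
          = g (insert c' S - {c'}) c * g (insert c' S - {c}) c'" by simp
      qed auto
      finally show ?thesis .
    qed
    then show ?thesis
      using sum_ksubsets_insert[OF fin,
          of "\<lambda>W c'. \<Sum>c\<in>W - {c'}. g (W - {c'}) c * g (W - {c}) c'" "Suc j"]
      by simp
  qed
  ultimately show ?thesis by (simp add: sum.distrib)
qed

section \<open>The upper bound for free hypergraphs\<close>

text \<open>The error term is the diagonal of the expanded square, at most \<open>k^3\<close> times
  the number of \<open>k\<close>-sets, divided by \<open>2 * k * (n - k)\<close> with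
  \<open>n\<close> the number of vertices; the factor \<open>n - k\<close> counts the sets
  \<open>W\<close> containing a given \<open>k\<close>-set.\<close>

lemma T_pdg_free_density_bound:
  fixes H :: "'a pdg"
  assumes fin: "finite (pverts H)" and H: "is_kpdg k H" and free: "pdg_free k (T_pdg k) H"
    and k: "k \<ge> 4" and n: "card (pverts H) > k"
  shows "pdg_alpha k H + 8 / 5 * pdg_beta k H
    \<le> 1 + (real k)\<^sup>2 / (2 * (real (card (pverts H)) - real k))"
proof -
  define V where "V = pverts H"
  define s where "s = pstate H"
  define N where "N = {S\<in>ksubsets k V. s S = No_Edge}"
  define D where "D = directed_edges k H"
  define U where "U = undirected_edges k H"
  define C where "C = real (card V choose k)"
  define \<nu> where "\<nu> = real (card V) - real k"
  have finV: "finite V" using fin by (simp add: V_def)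
  have \<nu>: "\<nu> > 0" using n by (simp add: \<nu>_def V_def)
  have C: "C > 0" using n by (simp add: C_def V_def)
  have finK: "finite (ksubsets j V)" for j using finite_ksubsets[OF finV] .
  obtain j where j: "k = Suc j" using k by (cases k) auto
  define g where "g S c = flag_weight k (s S) c" for S c
  define L where "L W = (\<Sum>c\<in>W. \<Sum>c'\<in>W - {c}. g (W - {c}) c' * g (W - {c'}) c)" for W
  have local: "L W + 6 / 5 * real k * (\<Sum>c\<in>W. of_bool (\<exists>a. s (W - {c}) = Directed a))
      \<le> 2 * real k * (\<Sum>c\<in>W. of_bool (s (W - {c}) = No_Edge))"
    if W: "W \<in> ksubsets (Suc k) V" for W
  proof -
    have fW: "finite W" "card W = k + 1" using W by (auto simp: ksubsets_def)
    have "L W + 6 / 5 * real k * real (card {c\<in>W. \<exists>a. s (W - {c}) = Directed a})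
        \<le> 2 * real k * real (card {c\<in>W. s (W - {c}) = No_Edge})"
      unfolding L_def g_def
    proof (rule local_quadratic_bound[OF fW k])
      fix c a assume "c \<in> W" "s (W - {c}) = Directed a"
      then show "a \<in> W \<and> a \<noteq> c" using H by (auto simp: is_kpdg_def s_def)
    next
      fix a b c assume "a \<in> W" "b \<in> W" "c \<in> W" "a \<noteq> b" "a \<noteq> c" "b \<noteq> c"
        "s (W - {c}) = Directed a" "s (W - {a}) \<noteq> No_Edge"
      then show "s (W - {b}) = No_Edge"
        using T_pdg_subgraphI[of W k H a b c] W k free
        by (auto simp: V_def s_def pdg_free_def)
    qed
    moreover have "real (card {c\<in>W. Q c}) = (\<Sum>c\<in>W. of_bool (Q c))" for Q
      using fW by (simp add: of_bool_def sum.If_cases Int_def)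
    ultimately show ?thesis by simp
  qed
  have count: "(\<Sum>S\<in>ksubsets k V. of_bool (Q S)) = real (card {S\<in>ksubsets k V. Q S})" for Q
    using finK by (simp add: of_bool_def sum.If_cases Int_def)
  have "(\<Sum>W\<in>ksubsets (Suc k) V. L W + 6 / 5 * real k * (\<Sum>c\<in>W. of_bool (\<exists>a. s (W - {c}) = Directed a)))
      \<le> (\<Sum>W\<in>ksubsets (Suc k) V. 2 * real k * (\<Sum>c\<in>W. of_bool (s (W - {c}) = No_Edge)))"
    using local by (rule sum_mono)
  then have "(\<Sum>W\<in>ksubsets (Suc k) V. L W) + 6 / 5 * real k *
        (\<Sum>W\<in>ksubsets (Suc k) V. \<Sum>c\<in>W. of_bool (\<exists>a. s (W - {c}) = Directed a))
      \<le> 2 * real k * (\<Sum>W\<in>ksubsets (Suc k) V. \<Sum>c\<in>W. of_bool (s (W - {c}) = No_Edge))"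
    by (simp only: sum.distrib sum_distrib_left)
  then have offdiag: "(\<Sum>W\<in>ksubsets (Suc k) V. L W) + 6 / 5 * real k * (\<nu> * real (card D))
      \<le> 2 * real k * (\<nu> * real (card N))"
    unfolding sum_ksubsets_remove[OF finV, where k = k and \<phi> = "\<lambda>S. of_bool (\<exists>a. s S = Directed a)"]
      sum_ksubsets_remove[OF finV, where k = k and \<phi> = "\<lambda>S. of_bool (s S = No_Edge)"] count
    by (simp add: \<nu>_def N_def D_def directed_edges_def V_def s_def)
  have diag: "(\<Sum>S\<in>ksubsets k V. \<Sum>c\<in>S. (g S c)\<^sup>2) \<le> C * (real k * (real k)\<^sup>2)"
  proof -
    \<comment> \<open>A crude bound suffices: the weights are \<open>3/5 * k - 1\<close>,
      \<open>-1\<close> and \<open>0\<close>.\<close>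
    have "(g S c)\<^sup>2 \<le> (real k)\<^sup>2" for S c
      using k by (intro abs_le_square_iff[THEN iffD1]) (auto simp: g_def flag_weight_def)
    then have "(\<Sum>c\<in>S. (g S c)\<^sup>2) \<le> real k * (real k)\<^sup>2" if "S \<in> ksubsets k V" for S
      using that sum_bounded_above[of S "\<lambda>c. (g S c)\<^sup>2" "(real k)\<^sup>2"] by (auto simp: ksubsets_def)
    then have "(\<Sum>S\<in>ksubsets k V. \<Sum>c\<in>S. (g S c)\<^sup>2) \<le> real (card (ksubsets k V)) * (real k * (real k)\<^sup>2)"
      by (rule sum_bounded_above)
    then show ?thesis by (simp add: C_def card_ksubsets[OF finV])
  qed
  have "0 \<le> (\<Sum>R\<in>ksubsets j V. (\<Sum>c\<in>V - R. g (insert c R) c)\<^sup>2)" by (intro sum_nonneg) auto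
  also have "\<dots> = (\<Sum>S\<in>ksubsets k V. \<Sum>c\<in>S. (g S c)\<^sup>2) + (\<Sum>W\<in>ksubsets (Suc k) V. L W)"
    using sum_square_ksubsets[OF finV, of g j] by (simp add: j L_def)
  finally have "0 \<le> C * (real k * (real k)\<^sup>2) + 2 * real k * (\<nu> * real (card N))
      - 6 / 5 * real k * (\<nu> * real (card D))"
    using diag offdiag by linarith
  then have "0 \<le> real k * (C * (real k)\<^sup>2 + 2 * \<nu> * real (card N) - 6 / 5 * \<nu> * real (card D))"
    by (simp add: algebra_simps)
  then have key: "0 \<le> C * (real k)\<^sup>2 + 2 * \<nu> * real (card N) - 6 / 5 * \<nu> * real (card D)"
    using k by (simp add: zero_le_mult_iff)
  have part: "card N + card D + card U = card (ksubsets k V)"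
  proof -
    have "ksubsets k V = (N \<union> D) \<union> U"
      by (auto simp: N_def D_def U_def directed_edges_def undirected_edges_def V_def s_def)
        (metis edge_state.exhaust)
    moreover have "N \<inter> D = {}" "(N \<union> D) \<inter> U = {}"
      by (auto simp: N_def D_def U_def directed_edges_def undirected_edges_def V_def s_def)
    moreover have "finite N" "finite D" "finite U"
      using finK[of k] by (auto simp: N_def D_def U_def directed_edges_def undirected_edges_def V_def)
    ultimately show ?thesis by (simp add: card_Un_disjoint)
  qed
  then have part': "real (card N) = C - real (card D) - real (card U)"
    unfolding C_def using card_ksubsets[OF finV, of k] by linarith
  \<comment> \<open>Eliminating non-edges adds \<open>2\<close> to the coefficient
    \<open>6/5\<close> of the directed edges, and \<open>2 + 6/5 = 2 * 8/5\<close> is the source of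
    \<theta>.\<close>
  have "2 * \<nu> * (real (card U) + 8 / 5 * real (card D)) \<le> C * (real k)\<^sup>2 + 2 * \<nu> * C"
    using key unfolding part' by (simp add: algebra_simps)
  then have "real (card U) + 8 / 5 * real (card D) \<le> C * (1 + (real k)\<^sup>2 / (2 * \<nu>))"
    using \<nu> by (simp add: field_simps)
  then have "(real (card U) + 8 / 5 * real (card D)) / C \<le> 1 + (real k)\<^sup>2 / (2 * \<nu>)"
    using C by (simp add: divide_le_eq mult.commute)
  then show ?thesis
    by (simp add: pdg_alpha_def pdg_beta_def U_def D_def C_def \<nu>_def V_def add_divide_distrib)
qed

text \<open>This covers hypergraphs with at most \<open>k\<close> vertices. If the binomial
  coefficient is zero, the quotient is zero by convention.\<close>

lemma pdg_density_le_1: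
  assumes "finite (pverts H)"
  shows "pdg_alpha k H \<le> 1" "pdg_beta k H \<le> 1"
proof -
  have *: "real (card X) / real (card (pverts H) choose k) \<le> 1" if "X \<subseteq> ksubsets k (pverts H)" for X
    using card_mono[OF finite_ksubsets[OF assms] that] card_ksubsets[OF assms, of k]
    by (intro divide_le_eq_1[THEN iffD2]) (simp add: zero_less_iff_neq_zero)
  show "pdg_alpha k H \<le> 1" "pdg_beta k H \<le> 1"
    unfolding pdg_alpha_def pdg_beta_def
    by (rule *; auto simp: undirected_edges_def directed_edges_def)+
qed

section \<open>The lower bound from complete hypergraphs\<close>

definition complete_pdg :: "nat \<Rightarrow> nat \<Rightarrow> nat pdg" where
  "complete_pdg k n =
    \<lparr>pverts = {..<n}, pstate = (\<lambda>S. if S \<in> ksubsets k {..<n} then Undirected else No_Edge)\<rparr>"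

text \<open>Reductions never create a direction, but \<open>T_pdg k\<close> has a directed
  edge.\<close>

lemma complete_pdg_T_free:
  assumes "k \<ge> 2"
  shows "pdg_free k (T_pdg k) (complete_pdg k n)"
  unfolding pdg_free_def pdg_subgraph_def
proof
  assume "\<exists>G. is_kpdg k G \<and> pdg_reduces k (complete_pdg k n) G \<and> pdg_iso k (T_pdg k) G"
  then obtain G f where red: "pdg_reduces k (complete_pdg k n) G"
    and f: "bij_betw f (pverts (T_pdg k)) (pverts G)"
    and st: "\<And>S. S \<in> ksubsets k (pverts (T_pdg k)) \<Longrightarrow>
      pstate G (f ` S) = map_edge_state f (pstate (T_pdg k) S)"
    unfolding pdg_iso_def by blast
  define S where "S = insert (k + 1) {1..k - 1}"
  have "card S = k" using assms by (simp add: S_def)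
  then have S: "S \<in> ksubsets k (pverts (T_pdg k))"
    by (auto simp: ksubsets_def T_pdg_def S_def)
  have "k \<notin> S" "k + 1 \<in> S" "k \<in> {2..k+1}" "k + 1 \<notin> {1..k}" using assms by (auto simp: S_def)
  then have "S \<noteq> {1..k}" "S \<noteq> {2..k+1}" by blast+
  then have "pstate (T_pdg k) S = Directed (k + 1)" by (simp add: T_pdg_def S_def)
  then have "pstate G (f ` S) = Directed (f (k + 1))" using st[OF S] by simp
  moreover have "f ` S \<in> ksubsets k (pverts G)"
    using S f by (auto simp: ksubsets_def bij_betw_def card_image inj_on_subset)
  ultimately have "pstate (complete_pdg k n) (f ` S) = Directed (f (k + 1))"
    using red by (force simp: pdg_reduces_def)
  then show False by (simp add: complete_pdg_def split: if_splits)
qed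

text \<open>For \<open>n < k\<close> the density would be \<open>0 / 0 = 0\<close>.\<close>

lemma complete_pdg_density:
  assumes "n \<ge> k"
  shows "pdg_alpha k (complete_pdg k n) = 1" "pdg_beta k (complete_pdg k n) = 0"
proof -
  have "undirected_edges k (complete_pdg k n) = ksubsets k {..<n}"
    "directed_edges k (complete_pdg k n) = {}"
    by (auto simp: undirected_edges_def directed_edges_def complete_pdg_def)
  then show "pdg_alpha k (complete_pdg k n) = 1" "pdg_beta k (complete_pdg k n) = 0"
    using assms card_ksubsets[of "{..<n}" k]
    by (simp_all add: pdg_alpha_def pdg_beta_def complete_pdg_def)
qed

section \<open>The extremal value\<close>

lemma pdg_pi_T_pdg:
  assumes k: "k \<ge> 4"
  shows "pdg_pi k (T_pdg k) (8 / 5) = 1"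
  unfolding pdg_pi_def
proof (rule Least_equality)
  \<comment> \<open>The value \<open>2\<close> works for \<open>n \<le> k\<close> because
    \<open>1 + 8/5 \<le> 1 + 2\<close>.\<close>
  define \<epsilon> where "\<epsilon> n = (if n > k then (real k)\<^sup>2 / (2 * (real n - real k)) else 2)" for n
  have "(\<lambda>n. (real k)\<^sup>2 / 2 * inverse (real n)) \<longlonglongrightarrow> (real k)\<^sup>2 / 2 * 0"
    by (intro tendsto_mult tendsto_const lim_inverse_n)
  \<comment> \<open>The shift by \<open>Suc k\<close> skips the exceptional values and turns
    \<open>n - k\<close> into \<open>Suc n\<close>.\<close>
  moreover have "\<epsilon> (n + Suc k) = (real k)\<^sup>2 / 2 * inverse (real (Suc n))" for n
    by (simp add: \<epsilon>_def field_simps)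
  ultimately have "(\<lambda>n. \<epsilon> (n + Suc k)) \<longlonglongrightarrow> 0"
    using LIMSEQ_Suc[of "\<lambda>n. (real k)\<^sup>2 / 2 * inverse (real n)"] by (simp only: mult_zero_right)
  then have "\<epsilon> \<longlonglongrightarrow> 0" by (rule LIMSEQ_offset)
  moreover have "pdg_alpha k H + 8 / 5 * pdg_beta k H \<le> 1 + \<epsilon> (card (pverts H))"
    if "finite (pverts H)" "is_kpdg k H" "pdg_free k (T_pdg k) H" for H :: "nat pdg"
    using T_pdg_free_density_bound[OF that k] pdg_density_le_1[OF that(1), of k]
    by (simp add: \<epsilon>_def)
  ultimately show "\<exists>\<epsilon>::nat \<Rightarrow> real. \<epsilon> \<longlonglongrightarrow> 0 \<and>
     (\<forall>H::nat pdg. finite (pverts H) \<longrightarrow> is_kpdg k H \<longrightarrow> pdg_free k (T_pdg k) H \<longrightarrow>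
        pdg_alpha k H + 8 / 5 * pdg_beta k H \<le> 1 + \<epsilon> (card (pverts H)))" by blast
next
  fix x :: real
  assume "\<exists>\<epsilon>::nat \<Rightarrow> real. \<epsilon> \<longlonglongrightarrow> 0 \<and>
     (\<forall>H::nat pdg. finite (pverts H) \<longrightarrow> is_kpdg k H \<longrightarrow> pdg_free k (T_pdg k) H \<longrightarrow>
        pdg_alpha k H + 8 / 5 * pdg_beta k H \<le> x + \<epsilon> (card (pverts H)))"
  then obtain \<epsilon> :: "nat \<Rightarrow> real" where lim: "\<epsilon> \<longlonglongrightarrow> 0"
    and le: "\<And>H::nat pdg. finite (pverts H) \<Longrightarrow> is_kpdg k H \<Longrightarrow> pdg_free k (T_pdg k) H \<Longrightarrow>
        pdg_alpha k H + 8 / 5 * pdg_beta k H \<le> x + \<epsilon> (card (pverts H))" by blast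
  \<comment> \<open>Complete hypergraphs test every large \<open>n\<close>, and letting
    \<open>n\<close> grow removes the error.\<close>
  have "1 \<le> x + \<epsilon> n" if "n \<ge> k" for n
  proof -
    have "is_kpdg k (complete_pdg k n)" by (auto simp: is_kpdg_def complete_pdg_def)
    then show ?thesis
      using le[of "complete_pdg k n"] complete_pdg_T_free[of k n] k complete_pdg_density[OF that]
      by (simp add: complete_pdg_def)
  qed
  moreover have "(\<lambda>n. x + \<epsilon> n) \<longlonglongrightarrow> x + 0" using lim by (intro tendsto_intros)
  ultimately show "1 \<le> x" using LIMSEQ_le_const[of "\<lambda>n. x + \<epsilon> n" x 1] by auto
qed

theorem theorem2p6:
  "\<exists>\<theta>::real. \<theta> > log 2 3 \<and> (\<forall>k::nat. k \<ge> 4 \<longrightarrow> pdg_pi k (T_pdg k) \<theta> = 1)"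
proof (intro exI conjI allI impI)
  have "5 * log 2 3 = log 2 (3 ^ 5 :: real)" by (subst log_nat_power) auto
  also have "\<dots> < log 2 (2 ^ 8)" by (subst log_less_cancel_iff) auto
  also have "\<dots> = 8" by (subst log_nat_power) auto
  finally show "log 2 3 < (8 / 5 :: real)" by simp
qed (rule pdg_pi_T_pdg)

end
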